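(* Let $q$ be a positive integer, $a>1$, and let $m\ge4$ be an integer. (1) For $p=2$, there exists a polynomial vector field of degree $m$ on $S_{p,q}$ with $3m-10$ invariant meridians, counted with multiplicity. (2) For $p=3$, there exists a polynomial vector field of degree $m$ on $S_{p,q}$ with $6m-21$ invariant meridians, counted with multiplicity.
   Context: Put $n=p+q+1$. $S_{p,q}\subset\mathbb{R}^n$ is the hypersurface $\{h=0\}$, where $h=\left(\sum_{i=1}^{p+1}x_i^2-a^2\right)^2+\sum_{j=p+2}^{n}x_j^2-1$. A polynomial vector field $\mathcal{X}=(R_1,\ldots,R_n)=\sum_iR_i\,\partial/\partial x_i$ has degree $\max_i\deg R_i$ and is a vector field on $S_{p,q}$ if $\mathcal{X}h=Kh$ for some $K\in\mathbb{R}[x_1,\ldots,x_n]$. A meridian on $S_{p,q}$ is the intersection of $S_{p,q}$ with a hyperplane $\{\sum_{i=1}^{p+1}a_ix_i=0\}$, $a_i\in\mathbb{R}$; it is invariant for $\mathcal{X}$ if $\mathcal{X}(\sum_ia_ix_i)=K\sum_ia_ix_i$ for some $K\in\mathbb{R}[x_1,\ldots,x_n]$. Multiplicity: let $W=\mathrm{span}\{x_1,\ldots,x_{p+1}\}$ and $\mathcal{E}_W(\mathcal{X})=\det\big(\mathcal{X}^{r-1}(x_s)\big)_{1\le r,s\le p+1}$ (the extactic polynomial). The multiplicity for $\mathcal{X}$ of the hyperplane $\{g=0\}$, $g\in W$, is the largest $\mu$ with $g^\mu\mid\mathcal{E}_W(\mathcal{X})$ if $\mathcal{E}_W(\mathcal{X})\neq0$,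 and is undefined if $\mathcal{E}_W(\mathcal{X})=0$. *)

theory Defs
  imports "HOL-Library.Poly_Mapping" "Jordan_Normal_Form.Determinant"
begin

text \<open>
  Real polynomials in the variables $x_0, x_1, \ldots$, as finitely supported families of
  coefficients indexed by exponent vectors. Indices start at 0, as they do for \<open>vec\<close>
  and \<open>mat\<close>: the variables $x_1, \ldots, x_n$ of $\mathbb{R}^n$ are \<open>Var 0, \<dots>, Var (n - 1)\<close>.
\<close>

type_synonym rpoly = "(nat \<Rightarrow>\<^sub>0 nat) \<Rightarrow>\<^sub>0 real"

definition Var :: "nat \<Rightarrow> rpoly" where
  "Var i = Poly_Mapping.single (Poly_Mapping.single i 1) 1"

definition Const :: "real \<Rightarrow> rpoly" where
  "Const c = Poly_Mapping.single 0 c"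

definition polys :: "nat \<Rightarrow> rpoly set" where
  "polys n = {f. \<forall>e \<in> Poly_Mapping.keys f. Poly_Mapping.keys e \<subseteq> {..<n}}"

text \<open>The zero polynomial gets degree 0.\<close>

definition total_degree :: "rpoly \<Rightarrow> nat" where
  "total_degree f =
     Max (insert 0 ((\<lambda>e. \<Sum>i \<in> Poly_Mapping.keys e. Poly_Mapping.lookup e i) ` Poly_Mapping.keys f))"

definition eval_poly :: "rpoly \<Rightarrow> real vec \<Rightarrow> real" where
  "eval_poly f v =
     (\<Sum>e \<in> Poly_Mapping.keys f. Poly_Mapping.lookup f e *
        (\<Prod>i \<in> Poly_Mapping.keys e. (v $ i) ^ Poly_Mapping.lookup e i))"

text \<open>
  The subtraction of exponents truncates only for exponents not involving \<open>i\<close>, where the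
  coefficient is 0.
\<close>

definition partial_deriv :: "nat \<Rightarrow> rpoly \<Rightarrow> rpoly" where
  "partial_deriv i f =
     (\<Sum>e \<in> Poly_Mapping.keys f.
        Poly_Mapping.single (e - Poly_Mapping.single i 1)
          (of_nat (Poly_Mapping.lookup e i) * Poly_Mapping.lookup f e))"

text \<open>
  A vector field on $\mathbb{R}^n$ is given by its components \<open>X 0, \<dots>, X (n - 1)\<close>; the values
  of \<open>X\<close> at other indices are never used.
\<close>

definition vf_apply :: "nat \<Rightarrow> (nat \<Rightarrow> rpoly) \<Rightarrow> rpoly \<Rightarrow> rpoly" where
  "vf_apply n X f = (\<Sum>i<n. X i * partial_deriv i f)"

definition vf_degree :: "nat \<Rightarrow> (nat \<Rightarrow> rpoly) \<Rightarrow> nat" where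
  "vf_degree n X = Max ((\<lambda>i. total_degree (X i)) ` {..<n})"

abbreviation ambient_dim :: "nat \<Rightarrow> nat \<Rightarrow> nat" where
  "ambient_dim p q \<equiv> p + q + 1"

definition S_poly :: "nat \<Rightarrow> nat \<Rightarrow> real \<Rightarrow> rpoly" where
  "S_poly p q a =
     ((\<Sum>i\<le>p. Var i ^ 2) - Const (a ^ 2)) ^ 2
       + (\<Sum>j \<in> {p + 1..<ambient_dim p q}. Var j ^ 2) - 1"

definition S_hypersurface :: "nat \<Rightarrow> nat \<Rightarrow> real \<Rightarrow> real vec set" where
  "S_hypersurface p q a =
     {v \<in> carrier_vec (ambient_dim p q). eval_poly (S_poly p q a) v = 0}"

definition poly_vector_field_on_S ::
  "nat \<Rightarrow> nat \<Rightarrow> real \<Rightarrow> (nat \<Rightarrow> rpoly) \<Rightarrow> bool" where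
  "poly_vector_field_on_S p q a X \<longleftrightarrow>
     (\<forall>i < ambient_dim p q. X i \<in> polys (ambient_dim p q)) \<and>
     (\<exists>K \<in> polys (ambient_dim p q).
        vf_apply (ambient_dim p q) X (S_poly p q a) = K * S_poly p q a)"

definition linear_form :: "nat \<Rightarrow> (nat \<Rightarrow> real) \<Rightarrow> rpoly" where
  "linear_form p c = (\<Sum>i\<le>p. Const (c i) * Var i)"

definition hyperplane :: "nat \<Rightarrow> nat \<Rightarrow> (nat \<Rightarrow> real) \<Rightarrow> real vec set" where
  "hyperplane p q c = {v \<in> carrier_vec (ambient_dim p q). eval_poly (linear_form p c) v = 0}"

text \<open>
  \<open>c\<close> are the coefficients of a linear form (nonzero, so that its zero set is a hyperplane)
  which cuts out the meridian \<open>M\<close>.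
\<close>

definition defines_meridian ::
  "nat \<Rightarrow> nat \<Rightarrow> real \<Rightarrow> (nat \<Rightarrow> real) \<Rightarrow> real vec set \<Rightarrow> bool" where
  "defines_meridian p q a c M \<longleftrightarrow>
     (\<exists>i\<le>p. c i \<noteq> 0) \<and> M = S_hypersurface p q a \<inter> hyperplane p q c"

definition invariant_meridians ::
  "nat \<Rightarrow> nat \<Rightarrow> real \<Rightarrow> (nat \<Rightarrow> rpoly) \<Rightarrow> real vec set set" where
  "invariant_meridians p q a X =
     {M. \<exists>c. defines_meridian p q a c M \<and>
        (\<exists>K \<in> polys (ambient_dim p q).
           vf_apply (ambient_dim p q) X (linear_form p c) = K * linear_form p c)}"

definition extactic :: "nat \<Rightarrow> nat \<Rightarrow> (nat \<Rightarrow> rpoly) \<Rightarrow> rpoly" where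
  "extactic p q X =
     det (mat (p + 1) (p + 1) (\<lambda>(r, s). (vf_apply (ambient_dim p q) X ^^ r) (Var s)))"

text \<open>
  Only meaningful if the extactic polynomial is nonzero. Divisibility in \<open>rpoly\<close> agrees with
  divisibility in \<open>polys (ambient_dim p q)\<close> for nonzero elements of the latter.
\<close>

definition hyperplane_multiplicity ::
  "nat \<Rightarrow> nat \<Rightarrow> (nat \<Rightarrow> rpoly) \<Rightarrow> (nat \<Rightarrow> real) \<Rightarrow> nat" where
  "hyperplane_multiplicity p q X c =
     (GREATEST \<mu>. linear_form p c ^ \<mu> dvd extactic p q X)"

text \<open>
  The multiplicity of a meridian is that of the hyperplane cutting it out. For \<open>p \<ge> 2\<close>,
  \<open>q \<ge> 1\<close> and \<open>a > 0\<close> a meridian determines its hyperplane, hence \<open>c\<close> up to a scalar.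
\<close>

definition meridian_multiplicity ::
  "nat \<Rightarrow> nat \<Rightarrow> real \<Rightarrow> (nat \<Rightarrow> rpoly) \<Rightarrow> real vec set \<Rightarrow> nat" where
  "meridian_multiplicity p q a X M =
     (THE \<mu>. \<exists>c. defines_meridian p q a c M \<and> \<mu> = hyperplane_multiplicity p q X c)"

definition num_invariant_meridians_with_mult ::
  "nat \<Rightarrow> nat \<Rightarrow> real \<Rightarrow> (nat \<Rightarrow> rpoly) \<Rightarrow> nat \<Rightarrow> bool" where
  "num_invariant_meridians_with_mult p q a X N \<longleftrightarrow>
     extactic p q X \<noteq> 0 \<and>
     finite (invariant_meridians p q a X) \<and>
     (\<Sum>M \<in> invariant_meridians p q a X. meridian_multiplicity p q a X M) = N"

end

theory Submission
  imports Defs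
begin

text \<open>
  One family of vector fields serves for all \<open>p \<ge> 1\<close>. Write \<open>x\<^sub>0, \<dots>, x\<^sub>p\<close> for the first group of variables
  and put \<open>Z\<^sub>i = (p - i) x\<^sub>i x\<^sub>p\<close> for \<open>i < p\<close>, \<open>Z\<^sub>p = - \<Sum>i<p. (p - i) x\<^sub>i\<^sup>2\<close>, and \<open>Z\<^sub>j = 0\<close> for the other
  variables. Then \<open>Z\<close> annihilates \<open>\<Sum>i\<le>p. x\<^sub>i\<^sup>2\<close> and the other variables, hence also the polynomial \<open>h\<close>
  defining the hypersurface, and the \<open>p\<close> hyperplanes \<open>x\<^sub>s = 0\<close> with \<open>s < p\<close> are invariant. No other
  linear form in \<open>x\<^sub>0, \<dots>, x\<^sub>p\<close> is invariant, because the weights \<open>p - i\<close> are distinct and those with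
  \<open>i < p\<close> are positive (\<open>invariant_linear_form_is_axis\<close>).

  These properties survive multiplication of \<open>Z\<close> by a polynomial \<open>G\<close> whose factors among these linear
  forms are all multiples of some \<open>x\<^sub>s\<close> with \<open>s < p\<close>, and the extactic polynomial is then multiplied by
  \<open>G\<close> to the power \<open>0 + 1 + \<dots> + p = p (p + 1) / 2\<close>
  (\<open>det_iterates_rescaled\<close>). For \<open>G = y\<^sup>2 x\<^sub>0\<^sup>k\<close> with \<open>k = m - 4\<close> and a variable \<open>y\<close> of the second group, the
  field \<open>G Z\<close> has degree \<open>m\<close>. The factor \<open>y\<^sup>2\<close> contributes no meridian, while \<open>x\<^sub>0\<^sup>k\<close> adds \<open>k p (p + 1) / 2\<close> to
  the multiplicity of the meridian \<open>x\<^sub>0 = 0\<close>.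

  What has to be seen is that each of the \<open>p\<close> meridians has multiplicity exactly 1 for \<open>Z\<close> itself. The
  extactic polynomial of \<open>Z\<close> is \<open>x\<^sub>0 \<cdots> x\<^sub>p\<^sub>-\<^sub>1 F\<close>, and at the common point \<open>(0, \<dots>, 0, 1)\<close> of these hyperplanes,
  a zero of \<open>Z\<close>, the determinant \<open>F\<close> is the Vandermonde determinant of the weights, which is not 0
  (\<open>extactic_meridian_field\<close>). So no \<open>x\<^sub>s\<close> with \<open>s < p\<close> divides \<open>F\<close>. Altogether there are
  \<open>p + (m - 4) p (p + 1) / 2\<close> invariant meridians counted with multiplicity. This number is \<open>3 m - 10\<close> for
  \<open>p = 2\<close> and \<open>6 m - 21\<close> for \<open>p = 3\<close>.
\<close>

section \<open>Evaluation and partial derivatives\<close>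

lemma sum_of_monomials:
  fixes f :: rpoly
  shows "(\<Sum>e\<in>Poly_Mapping.keys f. Poly_Mapping.single e (Poly_Mapping.lookup f e)) = f"
  by (rule poly_mapping_eqI) (simp add: lookup_sum lookup_single when_def in_keys_iff)

text \<open>Evaluation and partial derivatives are additive, so their product rules need only be
  checked on monomials; this is the induction that reduces to them.\<close>

lemma rpoly_induct [case_names single add]:
  fixes f :: rpoly
  assumes single: "\<And>e c. P (Poly_Mapping.single e c)"
    and add: "\<And>f g. P f \<Longrightarrow> P g \<Longrightarrow> P (f + g)"
  shows "P f"
proof -
  have sum: "P (\<Sum>e\<in>A. Poly_Mapping.single e (Poly_Mapping.lookup f e))" if "finite A" for A
    using that
  proof (induction A)
    case empty
    show ?case using single[of 0 0] by simp
  next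
    case (insert x A)
    then show ?case using single add by simp
  qed
  show ?thesis using sum[of "Poly_Mapping.keys f"] by (simp add: sum_of_monomials)
qed

lemma eval_poly_add: "eval_poly (f + g) v = eval_poly f v + eval_poly g v"
  unfolding eval_poly_def
  by (rule setsum_keys_plus_distrib) (simp_all add: algebra_simps)

lemma eval_poly_single:
  "eval_poly (Poly_Mapping.single e c) v =
     c * (\<Prod>i\<in>Poly_Mapping.keys e. (v $ i) ^ Poly_Mapping.lookup e i)"
  by (simp add: eval_poly_def)

lemma eval_monomial_add:
  fixes v :: "real vec" and d e :: "nat \<Rightarrow>\<^sub>0 nat"
  shows "(\<Prod>i\<in>Poly_Mapping.keys (d + e). (v $ i) ^ Poly_Mapping.lookup (d + e) i) =
     (\<Prod>i\<in>Poly_Mapping.keys d. (v $ i) ^ Poly_Mapping.lookup d i) *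
     (\<Prod>i\<in>Poly_Mapping.keys e. (v $ i) ^ Poly_Mapping.lookup e i)"
proof -
  let ?A = "Poly_Mapping.keys d \<union> Poly_Mapping.keys e"
  have extend: "(\<Prod>i\<in>Poly_Mapping.keys b. (v $ i) ^ Poly_Mapping.lookup b i) =
      (\<Prod>i\<in>?A. (v $ i) ^ Poly_Mapping.lookup b i)" if "Poly_Mapping.keys b \<subseteq> ?A" for b :: "nat \<Rightarrow>\<^sub>0 nat"
    using that by (intro prod.mono_neutral_left) (auto simp: in_keys_iff)
  show ?thesis
    using extend[of d] extend[of e] extend[OF keys_add]
    by (simp add: lookup_add power_add prod.distrib)
qed

lemma eval_poly_mult: "eval_poly (f * g) v = eval_poly f v * eval_poly g v"
proof (induction f rule: rpoly_induct)
  case (single d b)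
  show ?case
    by (induction g rule: rpoly_induct)
      (simp_all add: mult_single eval_poly_single eval_monomial_add distrib_left eval_poly_add)
qed (simp add: distrib_right eval_poly_add)

interpretation eval: comm_ring_hom "\<lambda>f. eval_poly f v"
proof
  show "eval_poly 1 v = 1" using eval_poly_single[of 0 1 v] by simp
qed (simp_all add: eval_poly_add eval_poly_mult, simp add: eval_poly_def)

lemma eval_poly_Var [simp]: "eval_poly (Var i) v = v $ i"
  by (simp add: Var_def eval_poly_single)

lemma eval_poly_Const [simp]: "eval_poly (Const c) v = c"
  by (simp add: Const_def eval_poly_single)

lemma partial_deriv_add: "partial_deriv i (f + g) = partial_deriv i f + partial_deriv i g"
  unfolding partial_deriv_def
  by (rule setsum_keys_plus_distrib) (simp_all add: single_add distrib_left)

lemma partial_deriv_single: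
  "partial_deriv i (Poly_Mapping.single e c) =
     Poly_Mapping.single (e - Poly_Mapping.single i 1) (of_nat (Poly_Mapping.lookup e i) * c)"
  by (simp add: partial_deriv_def)

text \<open>Truncation of exponents does no harm here, because the variable \<open>i\<close> occurs in \<open>d\<close>.\<close>

lemma diff_single_add:
  fixes d e :: "nat \<Rightarrow>\<^sub>0 nat"
  assumes "Poly_Mapping.lookup d i \<noteq> 0"
  shows "(d - Poly_Mapping.single i 1) + e = (d + e) - Poly_Mapping.single i 1"
  using assms by (intro poly_mapping_eqI) (auto simp: lookup_add lookup_minus lookup_single when_def)

lemma partial_deriv_single_mult_single:
  "partial_deriv i (Poly_Mapping.single d b * Poly_Mapping.single e c) =
     partial_deriv i (Poly_Mapping.single d b) * Poly_Mapping.single e c +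
     Poly_Mapping.single d b * partial_deriv i (Poly_Mapping.single e c)"
proof -
  \<comment> \<open>If the variable is absent from a factor, the exponents may differ, but the coefficient is 0.\<close>
  have "Poly_Mapping.single (d - Poly_Mapping.single i 1 + e) (of_nat (Poly_Mapping.lookup d i) * b * c) =
      Poly_Mapping.single (d + e - Poly_Mapping.single i 1) (of_nat (Poly_Mapping.lookup d i) * b * c)"
    using diff_single_add[of d i e]
    by (cases "Poly_Mapping.lookup d i = 0") simp_all
  moreover have "Poly_Mapping.single (d + (e - Poly_Mapping.single i 1)) (b * (of_nat (Poly_Mapping.lookup e i) * c)) =
      Poly_Mapping.single (d + e - Poly_Mapping.single i 1) (b * (of_nat (Poly_Mapping.lookup e i) * c))"
    using diff_single_add[of e i d]
    by (cases "Poly_Mapping.lookup e i = 0") (simp_all add: add.commute)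
  ultimately show ?thesis
    by (simp add: partial_deriv_single mult_single lookup_add algebra_simps flip: single_add)
qed

lemma partial_deriv_mult:
  "partial_deriv i (f * g) = partial_deriv i f * g + f * partial_deriv i g"
proof (induction f rule: rpoly_induct)
  case (single d b)
  show ?case
    by (induction g rule: rpoly_induct)
      (simp_all add: partial_deriv_single_mult_single partial_deriv_add algebra_simps)
qed (simp add: algebra_simps partial_deriv_add)

lemma partial_deriv_Var: "partial_deriv i (Var j) = (if i = j then 1 else 0)"
  by (simp add: Var_def partial_deriv_single lookup_single when_def)

lemma partial_deriv_Const: "partial_deriv i (Const c) = 0"
  by (simp add: Const_def partial_deriv_single)

lemma vf_apply_add: "vf_apply n X (f + g) = vf_apply n X f + vf_apply n X g"
  by (simp add: vf_apply_def partial_deriv_add distrib_left sum.distrib)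

lemma vf_apply_mult: "vf_apply n X (f * g) = vf_apply n X f * g + f * vf_apply n X g"
  by (simp add: vf_apply_def partial_deriv_mult distrib_left sum.distrib sum_distrib_left
      sum_distrib_right mult_ac)

lemma vf_apply_Var: "j < n \<Longrightarrow> vf_apply n X (Var j) = X j"
  by (simp add: vf_apply_def partial_deriv_Var if_distrib if_distribR cong: if_cong)

lemma vf_apply_Const: "vf_apply n X (Const c) = 0"
  by (simp add: vf_apply_def partial_deriv_Const)

lemma vf_apply_scale: "vf_apply n (\<lambda>i. G * Z i) f = G * vf_apply n Z f"
  by (simp add: vf_apply_def sum_distrib_left mult_ac)

section \<open>Membership in polynomial rings and homogeneity\<close>

lemma polys_Const [intro]: "Const c \<in> polys n"
  by (auto simp: polys_def Const_def)

lemma polys_Var [intro]: "i < n \<Longrightarrow> Var i \<in> polys n"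
  by (auto simp: polys_def Var_def)

lemma polys_zero [intro]: "0 \<in> polys n"
  by (simp add: polys_def)

lemma polys_one [intro]: "1 \<in> polys n"
  by (simp add: polys_def)

lemma polys_uminus [intro]: "f \<in> polys n \<Longrightarrow> - f \<in> polys n"
  by (simp add: polys_def in_keys_iff)

lemma polys_add [intro]: "f \<in> polys n \<Longrightarrow> g \<in> polys n \<Longrightarrow> f + g \<in> polys n"
  unfolding polys_def using keys_add[of f g] by blast

lemma polys_mult [intro]:
  assumes "f \<in> polys n" and "g \<in> polys n"
  shows "f * g \<in> polys n"
proof -
  have "Poly_Mapping.keys e \<subseteq> {..<n}" if e: "e \<in> Poly_Mapping.keys (f * g)" for e
  proof -
    obtain d b where "d \<in> Poly_Mapping.keys f" "b \<in> Poly_Mapping.keys g" "e = d + b"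
      using e keys_mult[of f g] by blast
    then show ?thesis
      using assms keys_add[of d b] unfolding polys_def by blast
  qed
  then show ?thesis by (simp add: polys_def)
qed

lemma polys_power [intro]: "f \<in> polys n \<Longrightarrow> f ^ k \<in> polys n"
  by (induction k) auto

lemma polys_sum [intro]: "(\<And>i. i \<in> A \<Longrightarrow> f i \<in> polys n) \<Longrightarrow> (\<Sum>i\<in>A. f i) \<in> polys n"
  by (induction A rule: infinite_finite_induct) auto

text \<open>The components of the field constructed below are homogeneous, which makes their degree
  immediate. The zero polynomial is homogeneous of every degree, so components that vanish need no
  special treatment.\<close>

definition homogeneous :: "nat \<Rightarrow> rpoly \<Rightarrow> bool" where
  "homogeneous d f \<longleftrightarrow>
     (\<forall>e\<in>Poly_Mapping.keys f. (\<Sum>i\<in>Poly_Mapping.keys e. Poly_Mapping.lookup e i) = d)"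

lemma total_degree_homogeneous:
  assumes "homogeneous d f"
  shows "total_degree f = (if f = 0 then 0 else d)"
proof (cases "f = 0")
  case False
  then have "Poly_Mapping.keys f \<noteq> {}" by simp
  moreover have "(\<lambda>e. \<Sum>i\<in>Poly_Mapping.keys e. Poly_Mapping.lookup e i) ` Poly_Mapping.keys f \<subseteq> {d}"
    using assms by (auto simp: homogeneous_def)
  ultimately have "(\<lambda>e. \<Sum>i\<in>Poly_Mapping.keys e. Poly_Mapping.lookup e i) ` Poly_Mapping.keys f = {d}"
    by blast
  then show ?thesis using False by (simp add: total_degree_def)
qed (simp add: total_degree_def)

lemma homogeneous_Const: "homogeneous 0 (Const c)"
  by (simp add: homogeneous_def Const_def)

lemma homogeneous_Var: "homogeneous 1 (Var i)"
  by (simp add: homogeneous_def Var_def)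

lemma homogeneous_zero: "homogeneous d 0"
  by (simp add: homogeneous_def)

lemma homogeneous_add: "homogeneous d f \<Longrightarrow> homogeneous d g \<Longrightarrow> homogeneous d (f + g)"
  unfolding homogeneous_def using keys_add[of f g] by blast

lemma homogeneous_uminus: "homogeneous d f \<Longrightarrow> homogeneous d (- f)"
  by (simp add: homogeneous_def in_keys_iff)

lemma homogeneous_sum: "(\<And>i. i \<in> A \<Longrightarrow> homogeneous d (f i)) \<Longrightarrow> homogeneous d (\<Sum>i\<in>A. f i)"
  by (induction A rule: infinite_finite_induct) (auto intro: homogeneous_add homogeneous_zero)

lemma homogeneous_mult:
  assumes "homogeneous d f" and "homogeneous e g"
  shows "homogeneous (d + e) (f * g)"
  unfolding homogeneous_def
proof
  fix b assume "b \<in> Poly_Mapping.keys (f * g)"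
  then obtain u v where uv: "u \<in> Poly_Mapping.keys f" "v \<in> Poly_Mapping.keys g" and b: "b = u + v"
    using keys_mult[of f g] by blast
  have "(\<Sum>i\<in>Poly_Mapping.keys (u + v). Poly_Mapping.lookup (u + v) i) =
      (\<Sum>i\<in>Poly_Mapping.keys u. Poly_Mapping.lookup u i) + (\<Sum>i\<in>Poly_Mapping.keys v. Poly_Mapping.lookup v i)"
    by (rule setsum_keys_plus_distrib) simp_all
  then show "(\<Sum>i\<in>Poly_Mapping.keys b. Poly_Mapping.lookup b i) = d + e"
    using assms uv by (simp add: b homogeneous_def)
qed

lemma homogeneous_power:
  assumes "homogeneous d f"
  shows "homogeneous (k * d) (f ^ k)"
proof (induction k)
  case 0
  show ?case by (simp add: homogeneous_def)
next
  case (Suc k)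
  then show ?case using homogeneous_mult[OF assms, of "k * d" "f ^ k"] by simp
qed

section \<open>Powers of a variable dividing a monomial multiple\<close>

lemma Var_nonzero [simp]: "Var i \<noteq> 0"
  by (metis Var_def lookup_single_eq lookup_zero zero_neq_one)

lemma lookup_monomial_mult:
  "Poly_Mapping.lookup (Poly_Mapping.single d 1 * f) (d + e) = Poly_Mapping.lookup (f :: rpoly) e"
  by (induction f rule: rpoly_induct)
    (simp_all add: mult_single lookup_single when_def lookup_add distrib_left)

text \<open>The special case of primality of a variable that is needed: multiplication by another
  variable does not change the exponent of \<open>Var s\<close> in any monomial.\<close>

lemma Var_dvd_Var_mult_cancel:
  assumes dvd: "Var s dvd Var j * f" and "s \<noteq> j"
  shows "Var s dvd f"
proof -
  obtain g where g: "Var j * f = Var s * g" using dvd by (rule dvdE)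
  have "Var s dvd Poly_Mapping.single e (Poly_Mapping.lookup f e)" if e: "e \<in> Poly_Mapping.keys f" for e
  proof -
    have "Poly_Mapping.single j 1 + e \<in> Poly_Mapping.keys (Var j * f)"
      unfolding in_keys_iff Var_def lookup_monomial_mult using e by (simp add: in_keys_iff)
    then obtain d b where "Poly_Mapping.single j 1 + e = d + b" and "d \<in> Poly_Mapping.keys (Var s)"
      using keys_mult[of "Var s" g] unfolding g by blast
    then have "Poly_Mapping.single j 1 + e = Poly_Mapping.single s 1 + b"
      by (simp add: Var_def)
    then have "Poly_Mapping.lookup (Poly_Mapping.single j 1 + e) s =
        Poly_Mapping.lookup (Poly_Mapping.single s 1 + b) s" by simp
    then have "Poly_Mapping.lookup e s \<noteq> 0"
      using \<open>s \<noteq> j\<close> by (simp add: lookup_add lookup_single when_def)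
    then have "Poly_Mapping.single s 1 + (e - Poly_Mapping.single s 1) = e"
      by (intro poly_mapping_eqI) (auto simp: lookup_add lookup_minus lookup_single when_def)
    then have "Poly_Mapping.single e (Poly_Mapping.lookup f e) =
        Var s * Poly_Mapping.single (e - Poly_Mapping.single s 1) (Poly_Mapping.lookup f e)"
      by (simp add: Var_def mult_single)
    then show ?thesis by simp
  qed
  then have "Var s dvd (\<Sum>e\<in>Poly_Mapping.keys f. Poly_Mapping.single e (Poly_Mapping.lookup f e))"
    by (intro dvd_sum) auto
  then show ?thesis by (simp add: sum_of_monomials)
qed

lemma Var_dvd_monomial_mult_cancel:
  assumes "finite J" and "s \<notin> J" and "Var s dvd (\<Prod>j\<in>J. Var j ^ \<mu> j) * F"
  shows "Var s dvd F"
proof -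
  have power: "Var s dvd f" if "s \<noteq> j" and "Var s dvd Var j ^ k * f" for j k f
    using that by (induction k) (auto simp: mult.assoc dest: Var_dvd_Var_mult_cancel)
  from assms show ?thesis
    by (induction J) (auto simp: mult.assoc dest: power)
qed

text \<open>This reads off a multiplicity from a factorization, once the cofactor of the monomial is
  known not to be divisible by the variable.\<close>

lemma Var_power_dvd_monomial_mult_iff:
  assumes J: "finite J" "s \<in> J" and F: "\<not> Var s dvd F"
  shows "Var s ^ n dvd (\<Prod>j\<in>J. Var j ^ \<mu> j) * F \<longleftrightarrow> n \<le> \<mu> s"
proof -
  define R where "R = (\<Prod>j\<in>J - {s}. Var j ^ \<mu> j) * F"
  have split: "(\<Prod>j\<in>J. Var j ^ \<mu> j) * F = Var s ^ \<mu> s * R"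
    using J by (simp add: R_def prod.remove mult.assoc)
  have R: "\<not> Var s dvd R"
    using Var_dvd_monomial_mult_cancel[of "J - {s}" s \<mu> F] J F by (auto simp: R_def)
  show ?thesis
  proof
    assume dvd: "Var s ^ n dvd (\<Prod>j\<in>J. Var j ^ \<mu> j) * F"
    show "n \<le> \<mu> s"
    proof (rule ccontr)
      assume "\<not> n \<le> \<mu> s"
      then have "Var s ^ \<mu> s * Var s dvd Var s ^ n"
        using le_imp_power_dvd[of "Suc (\<mu> s)" n "Var s"] by (simp add: mult.commute)
      then have "Var s ^ \<mu> s * Var s dvd Var s ^ \<mu> s * R"
        by (rule dvd_trans[OF _ dvd[unfolded split]])
      then show False using R by simp
    qed
  next
    assume "n \<le> \<mu> s"
    then show "Var s ^ n dvd (\<Prod>j\<in>J. Var j ^ \<mu> j) * F"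
      unfolding split by (intro dvd_mult2 le_imp_power_dvd)
  qed
qed

section \<open>Wronskian-type determinants of a derivation\<close>

locale derivation =
  fixes D :: "'a :: comm_ring_1 \<Rightarrow> 'a"
  assumes add: "D (f + g) = D f + D g"
    and mult: "D (f * g) = D f * g + f * D g"
begin

lemma zero [simp]: "D 0 = 0"
  using add[of 0 0] by simp

lemma sum: "D (\<Sum>i\<in>A. f i) = (\<Sum>i\<in>A. D (f i))"
  by (induction A rule: infinite_finite_induct) (simp_all add: add)

lemma one [simp]: "D 1 = 0"
  using mult[of 1 1] by simp

text \<open>For an eigenvector-like element, with cofactor \<open>K\<close>, all iterates remain multiples of it.
  Applied to an invariant linear form, it makes that form a common factor of a column of the
  extactic determinant.\<close>

lemma iterate_cofactor:
  assumes "D x = K * x"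
  shows "(D ^^ r) x = ((\<lambda>g. D g + K * g) ^^ r) 1 * x"
proof (induction r)
  case (Suc r)
  then show ?case by (simp add: mult assms algebra_simps)
qed simp

text \<open>The iterates of \<open>G * D\<close> are linear combinations of those of \<open>D\<close>. The matrix of coefficients
  is lower triangular, with powers of \<open>G\<close> on the diagonal.\<close>

fun rescale_coeff :: "'a \<Rightarrow> nat \<Rightarrow> nat \<Rightarrow> 'a" where
  "rescale_coeff G 0 k = (if k = 0 then 1 else 0)"
| "rescale_coeff G (Suc r) k =
     G * D (rescale_coeff G r k) + (if k = 0 then 0 else G * rescale_coeff G r (k - 1))"

lemma rescale_coeff_above [simp]: "r < k \<Longrightarrow> rescale_coeff G r k = 0"
  by (induction r arbitrary: k) auto

lemma rescale_coeff_diagonal [simp]: "rescale_coeff G r r = G ^ r"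
  by (induction r) auto

lemma iterate_rescaled:
  assumes "r < N"
  shows "((\<lambda>g. G * D g) ^^ r) f = (\<Sum>k<N. rescale_coeff G r k * (D ^^ k) f)"
  using assms
proof (induction r)
  case 0
  then show ?case by (simp add: if_distribR if_distrib cong: if_cong)
next
  case (Suc r)
  then obtain N' where N': "N = Suc N'" "r < N'" by (cases N) auto
  have "((\<lambda>g. G * D g) ^^ Suc r) f = G * D (\<Sum>k<N. rescale_coeff G r k * (D ^^ k) f)"
    using Suc by simp
  also have "\<dots> = (\<Sum>k<N. G * D (rescale_coeff G r k) * (D ^^ k) f) +
      (\<Sum>k<N. G * rescale_coeff G r k * (D ^^ Suc k) f)"
    by (simp add: sum mult sum_distrib_left sum.distrib algebra_simps)
  also have "(\<Sum>k<N. G * rescale_coeff G r k * (D ^^ Suc k) f) =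
      (\<Sum>k<N'. G * rescale_coeff G r k * (D ^^ Suc k) f)"
    using N' by simp
  also have "\<dots> = (\<Sum>k<N. (if k = 0 then 0 else G * rescale_coeff G r (k - 1)) * (D ^^ k) f)"
    unfolding N' by (subst sum.lessThan_Suc_shift) simp
  finally show ?case by (simp add: sum.distrib algebra_simps)
qed

text \<open>A change of time multiplies the extactic determinant by a power of the time factor, because
  all contributions from derivatives of \<open>G\<close> lie below the diagonal.\<close>

lemma det_iterates_rescaled:
  "det (mat N N (\<lambda>(r, s). ((\<lambda>g. G * D g) ^^ r) (f s))) =
     G ^ (\<Sum>r<N. r) * det (mat N N (\<lambda>(r, s). (D ^^ r) (f s)))"
proof -
  let ?L = "mat N N (\<lambda>(r, k). rescale_coeff G r k)"
  let ?M = "mat N N (\<lambda>(r, s). (D ^^ r) (f s))"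
  have "mat N N (\<lambda>(r, s). ((\<lambda>g. G * D g) ^^ r) (f s)) = ?L * ?M"
    by (intro eq_matI) (auto simp: scalar_prod_def atLeast0LessThan iterate_rescaled)
  moreover have "det ?L = prod_list (diag_mat ?L)"
    by (rule det_lower_triangular[where n = N]) auto
  moreover have "prod_list (diag_mat ?L) = (\<Prod>r<N. G ^ r)"
    by (simp add: prod_list_diag_prod atLeast0LessThan)
  ultimately show ?thesis
    by (simp add: det_mult[where n = N] power_sum)
qed

end

lemma det_scale_columns:
  fixes d :: "nat \<Rightarrow> 'a :: comm_ring_1"
  shows "det (mat N N (\<lambda>(r, s). B r s * d s)) = det (mat N N (\<lambda>(r, s). B r s)) * (\<Prod>s<N. d s)"
proof -
  let ?D = "mat N N (\<lambda>(r, s). if r = s then d s else 0)"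
  have "mat N N (\<lambda>(r, s). B r s * d s) = mat N N (\<lambda>(r, s). B r s) * ?D"
    by (intro eq_matI) (auto simp: scalar_prod_def if_distrib cong: if_cong)
  moreover have "det ?D = prod_list (diag_mat ?D)"
    by (rule det_lower_triangular[where n = N]) auto
  moreover have "prod_list (diag_mat ?D) = (\<Prod>s<N. d s)"
    by (simp add: prod_list_diag_prod atLeast0LessThan)
  ultimately show ?thesis
    by (simp add: det_mult[where n = N])
qed

text \<open>A linear relation between the rows would be a nonzero polynomial of degree below \<open>N\<close> that
  vanishes at \<open>N\<close> nodes.\<close>

lemma vandermonde_det_nonzero:
  fixes x :: "nat \<Rightarrow> 'a :: field"
  assumes inj: "inj_on x {..<N}"
  shows "det (mat N N (\<lambda>(r, s). x s ^ r)) \<noteq> 0"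
proof
  let ?A = "mat N N (\<lambda>(r, s). x s ^ r)"
  assume "det ?A = 0"
  \<comment> \<open>The transpose turns a kernel vector into the coefficients of such a polynomial.\<close>
  then have "det (transpose_mat ?A) = 0"
    by (simp add: det_transpose[where n = N])
  then obtain v where v: "v \<in> carrier_vec N" "v \<noteq> 0\<^sub>v N" "transpose_mat ?A *\<^sub>v v = 0\<^sub>v N"
    by (subst (asm) det_0_iff_vec_prod_zero[where n = N]) auto
  define P where "P = (\<Sum>r<N. monom (v $ r) r)"
  have coeff: "coeff P r = (if r < N then v $ r else 0)" for r
    by (simp add: P_def coeff_sum)
  obtain r where r: "r < N" "v $ r \<noteq> 0"
    using v(1,2) by (metis carrier_vecD eq_vecI index_zero_vec)
  have nz: "P \<noteq> 0" using coeff[of r] r by auto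
  have "degree P < N"
    using r coeff by (intro degree_lessI) auto
  moreover have root: "poly P (x s) = 0" if "s < N" for s
  proof -
    have "(transpose_mat ?A *\<^sub>v v) $ s = 0" using v(3) that by simp
    then show ?thesis
      using that v(1) by (simp add: P_def poly_sum poly_monom scalar_prod_def atLeast0LessThan mult.commute)
  qed
  moreover have "card (x ` {..<N}) \<le> card {z. poly P z = 0}"
    by (rule card_mono) (auto simp: root poly_roots_finite[OF nz])
  ultimately show False
    using card_image[OF inj] card_poly_roots_bound[OF nz] by simp
qed

section \<open>Meridians and their linear forms\<close>

interpretation vf: derivation "vf_apply n X"
  by standard (simp_all add: vf_apply_add vf_apply_mult)

lemma eval_poly_linear_form: "eval_poly (linear_form p c) v = (\<Sum>i\<le>p. c i * v $ i)"
  by (simp add: linear_form_def eval.hom_sum eval_poly_mult)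

lemma eval_poly_S_poly:
  "eval_poly (S_poly p q a) v =
     ((\<Sum>i\<le>p. (v $ i)\<^sup>2) - a\<^sup>2)\<^sup>2 + (\<Sum>j\<in>{p + 1..<ambient_dim p q}. (v $ j)\<^sup>2) - 1"
  by (simp add: S_poly_def eval.hom_sum eval.hom_power eval.hom_minus eval_poly_add)

text \<open>A vector of the hyperplane can be scaled into the meridian, once the variables outside the
  linear form are adjusted: on the sphere \<open>\<Sum>x\<^sub>i\<^sup>2 = a\<^sup>2\<close> the equation reduces to \<open>\<Sum>y\<^sub>j\<^sup>2 = 1\<close>, which has a
  solution since \<open>q \<ge> 1\<close>.\<close>

lemma meridian_contains_direction:
  assumes q: "q \<ge> 1" and a: "a > 0" and x: "i0 \<le> p" "x i0 \<noteq> 0"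
    and c: "(\<Sum>i\<le>p. c i * x i) = 0"
  obtains v t where "t \<noteq> 0" "\<And>i. i \<le> p \<Longrightarrow> v $ i = t * x i"
    "v \<in> S_hypersurface p q a \<inter> hyperplane p q c"
proof -
  define N where "N = (\<Sum>i\<le>p. (x i)\<^sup>2)"
  have N: "N > 0"
    unfolding N_def using x by (intro sum_pos2[of _ i0]) auto
  define t where "t = a / sqrt N"
  have t: "t \<noteq> 0" "t\<^sup>2 * N = a\<^sup>2"
    using N a by (auto simp: t_def power_divide)
  define v where "v = vec (ambient_dim p q) (\<lambda>i. if i \<le> p then t * x i else if i = p + 1 then 1 else 0)"
  have v: "v $ i = t * x i" if "i \<le> p" for i
    using that by (simp add: v_def)
  have "(\<Sum>i\<le>p. (v $ i)\<^sup>2) = a\<^sup>2"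
    using t(2) by (simp add: v power_mult_distrib N_def sum_distrib_left)
  moreover have "(\<Sum>j\<in>{p + 1..<ambient_dim p q}. (v $ j)\<^sup>2) =
      (\<Sum>j\<in>{p + 1..<ambient_dim p q}. if j = p + 1 then 1 else 0)"
    by (intro sum.cong) (auto simp: v_def)
  ultimately have "eval_poly (S_poly p q a) v = 0"
    using q by (simp add: eval_poly_S_poly)
  moreover have "(\<Sum>i\<le>p. c i * v $ i) = t * (\<Sum>i\<le>p. c i * x i)"
    by (simp add: v sum_distrib_left mult_ac)
  then have "eval_poly (linear_form p c) v = 0"
    by (simp add: eval_poly_linear_form c)
  moreover have "v \<in> carrier_vec (ambient_dim p q)" by (simp add: v_def)
  ultimately show thesis
    using that[of t v] t v by (simp add: S_hypersurface_def hyperplane_def)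
qed

text \<open>If \<open>c i \<noteq> 0\<close>, the vectors \<open>c i * e\<^sub>j - c j * e\<^sub>i\<close> lie in the hyperplane of \<open>c\<close>. After scaling they lie
  on the meridian, hence in the hyperplane of \<open>c'\<close>, and this expresses \<open>c' j\<close> through \<open>c j\<close>.\<close>

lemma meridian_determines_linear_form:
  assumes q: "q \<ge> 1" and a: "a > 0"
    and c: "defines_meridian p q a c M" and c': "defines_meridian p q a c' M"
  obtains t where "\<And>i. i \<le> p \<Longrightarrow> c' i = t * c i"
proof -
  obtain i where i: "i \<le> p" "c i \<noteq> 0"
    using c by (auto simp: defines_meridian_def)
  have "c' j = (c' i / c i) * c j" if j: "j \<le> p" for j
  proof (cases "j = i")
    case False
    define x where "x = (\<lambda>l. (if l = j then c i else 0) - (if l = i then c j else 0))"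
    have x: "(\<Sum>l\<le>p. b l * x l) = b j * c i - b i * c j" for b
    proof -
      have "(\<Sum>l\<le>p. b l * x l) =
          (\<Sum>l\<le>p. (if l = j then b j * c i else 0) - (if l = i then b i * c j else 0))"
        by (intro sum.cong) (auto simp: x_def)
      then show ?thesis using i(1) j by (simp add: sum_subtractf)
    qed
    have "(\<Sum>l\<le>p. c l * x l) = 0" by (simp add: x)
    moreover have "x j \<noteq> 0" using False i(2) by (simp add: x_def)
    ultimately obtain v t where t: "t \<noteq> 0" "\<And>l. l \<le> p \<Longrightarrow> v $ l = t * x l"
        and v: "v \<in> S_hypersurface p q a \<inter> hyperplane p q c"
      using meridian_contains_direction[OF q a j] by metis
    then have "v \<in> hyperplane p q c'"
      using c c' by (auto simp: defines_meridian_def)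
    then have "(\<Sum>l\<le>p. c' l * (t * x l)) = 0"
      using t(2) by (simp add: hyperplane_def eval_poly_linear_form)
    then have "t * (\<Sum>l\<le>p. c' l * x l) = 0"
      by (simp add: sum_distrib_left mult_ac)
    then have "c' j * c i = c' i * c j"
      using t(1) by (simp add: x)
    then show ?thesis using i(2) by (simp add: field_simps)
  qed (use i in simp)
  then show thesis by (rule that)
qed

lemma linear_form_scale:
  assumes "\<And>i. i \<le> p \<Longrightarrow> c' i = t * c i"
  shows "linear_form p c' = Const t * linear_form p c"
proof -
  have "Const (t * b) = Const t * Const b" for b
    by (simp add: Const_def mult_single)
  then show ?thesis
    using assms by (simp add: linear_form_def sum_distrib_left mult.assoc)
qed

text \<open>Proportional linear forms have the same powers as divisors, so the multiplicity of a
  meridian can be computed from any form that cuts it out.\<close>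

lemma meridian_multiplicity_eq:
  assumes q: "q \<ge> 1" and a: "a > 0" and c: "defines_meridian p q a c M"
  shows "meridian_multiplicity p q a X M = hyperplane_multiplicity p q X c"
proof -
  have "hyperplane_multiplicity p q X c' = hyperplane_multiplicity p q X c"
    if c': "defines_meridian p q a c' M" for c'
  proof -
    have dvd: "linear_form p b dvd linear_form p b'"
      if b: "defines_meridian p q a b M" "defines_meridian p q a b' M" for b b'
    proof -
      obtain t where "\<And>i. i \<le> p \<Longrightarrow> b' i = t * b i"
        using meridian_determines_linear_form[OF q a b] by metis
      then show ?thesis using linear_form_scale by simp
    qed
    have "linear_form p c' ^ \<mu> dvd extactic p q X \<longleftrightarrow> linear_form p c ^ \<mu> dvd extactic p q X" for \<mu>
      using dvd_power_same[OF dvd[OF c c'], of \<mu>] dvd_power_same[OF dvd[OF c' c], of \<mu>] dvd_trans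
      by blast
    then show ?thesis by (simp add: hyperplane_multiplicity_def)
  qed
  then show ?thesis
    unfolding meridian_multiplicity_def using c by (intro the_equality) blast+
qed

section \<open>The vector field\<close>

text \<open>With all weights equal to 1 this would be the constant field in the negative direction of \<open>x\<^sub>p\<close>,
  projected to the spheres of the variables \<open>x\<^sub>0, \<dots>, x\<^sub>p\<close> and multiplied by the squared radius, so that
  it becomes polynomial. The weights \<open>p - i\<close> are there to be pairwise distinct,
  also from the weight 0 of \<open>x\<^sub>p\<close>, and positive for \<open>i < p\<close>.\<close>

definition quadratic_field :: "nat \<Rightarrow> nat \<Rightarrow> rpoly" where
  "quadratic_field p i =
     (if i < p then Const (real (p - i)) * Var i * Var p
      else if i = p then - (\<Sum>j<p. Const (real (p - j)) * Var j ^ 2)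
      else 0)"

text \<open>The factor \<open>x\<^sub>0\<^sup>k\<close> raises the multiplicity of one meridian. The square of the variable
  \<open>Var (p + 1)\<close>, which no meridian form involves, only brings the degree from 2 to 4.\<close>

definition time_scale :: "nat \<Rightarrow> nat \<Rightarrow> rpoly" where
  "time_scale p k = Var (p + 1) ^ 2 * Var 0 ^ k"

definition meridian_field :: "nat \<Rightarrow> nat \<Rightarrow> nat \<Rightarrow> rpoly" where
  "meridian_field p k = (\<lambda>i. time_scale p k * quadratic_field p i)"

lemma vf_apply_power2: "vf_apply n X (f ^ 2) = 2 * f * vf_apply n X f"
  by (simp add: power2_eq_square vf_apply_mult algebra_simps)

text \<open>The field is tangent to the spheres centred at the origin: its component along \<open>x\<^sub>p\<close> was
  chosen to cancel the contributions of all the others.\<close>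

lemma vf_apply_quadratic_field_norm:
  assumes "p < n"
  shows "vf_apply n (quadratic_field p) (\<Sum>i\<le>p. Var i ^ 2) = 0"
proof -
  have "vf_apply n (quadratic_field p) (\<Sum>i\<le>p. Var i ^ 2) =
      (\<Sum>i\<le>p. 2 * Var i * quadratic_field p i)"
    using assms by (simp add: vf.sum vf_apply_power2 vf_apply_Var)
  also have "\<dots> = (\<Sum>i<p. 2 * Var i * quadratic_field p i) + 2 * Var p * quadratic_field p p"
    by (simp flip: lessThan_Suc_atMost)
  also have "\<dots> = 0"
    by (simp add: quadratic_field_def sum_distrib_left power2_eq_square mult_ac sum_negf)
  finally show ?thesis .
qed

lemma vf_apply_quadratic_field_S_poly:
  "vf_apply (ambient_dim p q) (quadratic_field p) (S_poly p q a) = 0"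
proof -
  define n where "n = ambient_dim p q"
  have sub: "vf_apply n X (f - g) = vf_apply n X f - vf_apply n X g" for n X f g
    using vf_apply_add[of n X "f - g" g] by (simp add: eq_diff_eq)
  have "vf_apply n (quadratic_field p) (\<Sum>j\<in>{p + 1..<n}. Var j ^ 2) = 0"
    unfolding vf.sum by (intro sum.neutral) (simp add: vf_apply_power2 vf_apply_Var quadratic_field_def)
  moreover have "vf_apply n (quadratic_field p) (\<Sum>i\<le>p. Var i ^ 2) = 0"
    by (rule vf_apply_quadratic_field_norm) (simp add: n_def)
  ultimately show ?thesis
    unfolding S_poly_def n_def[symmetric]
    by (simp add: sub vf_apply_add vf_apply_power2 vf_apply_Const)
qed

lemma quadratic_field_polys: "i < ambient_dim p q \<Longrightarrow> quadratic_field p i \<in> polys (ambient_dim p q)"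
  unfolding quadratic_field_def by (auto intro!: polys_mult polys_uminus polys_sum polys_power)

lemma time_scale_polys:
  assumes "q \<ge> 1"
  shows "time_scale p k \<in> polys (ambient_dim p q)"
  using assms unfolding time_scale_def by (auto intro!: polys_mult polys_power polys_Var)

lemma meridian_field_on_S:
  assumes "q \<ge> 1"
  shows "poly_vector_field_on_S p q a (meridian_field p k)"
proof -
  have "vf_apply (ambient_dim p q) (meridian_field p k) (S_poly p q a) = 0 * S_poly p q a"
    unfolding meridian_field_def vf_apply_scale vf_apply_quadratic_field_S_poly by simp
  then show ?thesis
    unfolding poly_vector_field_on_S_def meridian_field_def
    using time_scale_polys[OF assms] quadratic_field_polys by blast
qed

lemma homogeneous_meridian_field: "homogeneous (k + 4) (meridian_field p k i)"
proof -
  have "homogeneous 2 (quadratic_field p i)"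
    unfolding quadratic_field_def
    using homogeneous_mult[OF homogeneous_mult[OF homogeneous_Const homogeneous_Var] homogeneous_Var]
      homogeneous_mult[OF homogeneous_Const homogeneous_power[OF homogeneous_Var, of 2]]
    by (auto simp: numeral_2_eq_2 intro!: homogeneous_uminus homogeneous_sum homogeneous_zero)
  moreover have "homogeneous (k + 2) (time_scale p k)"
    using homogeneous_mult[OF homogeneous_power[OF homogeneous_Var, of 2 "p + 1"] homogeneous_power[OF homogeneous_Var, of k 0]]
    by (simp add: time_scale_def add.commute)
  ultimately show ?thesis
    using homogeneous_mult[of "k + 2" "time_scale p k" 2 "quadratic_field p i"]
    by (simp add: meridian_field_def numeral_eq_Suc)
qed

lemma degree_meridian_field:
  assumes p: "p \<ge> 1"
  shows "vf_degree (ambient_dim p q) (meridian_field p k) = k + 4"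
proof -
  have le: "total_degree (meridian_field p k i) \<le> k + 4" for i
    by (simp add: total_degree_homogeneous[OF homogeneous_meridian_field])
  have "Const (real p) \<noteq> 0"
    using eval_poly_Const[of "real p"] p by fastforce
  then have "meridian_field p k 0 \<noteq> 0"
    using p by (simp add: meridian_field_def time_scale_def quadratic_field_def)
  then have "total_degree (meridian_field p k 0) = k + 4"
    by (simp add: total_degree_homogeneous[OF homogeneous_meridian_field])
  then show ?thesis
    unfolding vf_degree_def by (intro Max_eqI) (auto simp: le intro!: image_eqI[of _ _ 0])
qed

section \<open>The invariant meridians\<close>

definition axis :: "nat \<Rightarrow> nat \<Rightarrow> real" where
  "axis s = (\<lambda>i. if i = s then 1 else 0)"

lemma Const_1 [simp]: "Const 1 = 1"
  by (simp add: Const_def)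

lemma Const_0 [simp]: "Const 0 = 0"
  by (simp add: Const_def)

lemma linear_form_axis: "s \<le> p \<Longrightarrow> linear_form p (axis s) = Var s"
  by (simp add: linear_form_def axis_def if_distrib if_distribR cong: if_cong)

text \<open>An invariant form divides its derivative, so the derivative vanishes on the hyperplane.
  Where the time factor is nonzero, this leaves the quadratic identity \<open>on_zero_set\<close>, and evaluating it at
  suitable points of the hyperplane excludes all forms but the multiples of \<open>x\<^sub>s\<close>, \<open>s < p\<close>.\<close>

lemma invariant_linear_form_is_axis:
  assumes p: "p \<ge> 1" and q: "q \<ge> 1" and nz: "\<exists>i\<le>p. c i \<noteq> 0"
    and inv: "vf_apply (ambient_dim p q) (meridian_field p k) (linear_form p c) = K * linear_form p c"
  obtains s where "s < p" "\<And>i. i \<le> p \<Longrightarrow> c i = c s * axis s i"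
proof -
  have form: "vf_apply (ambient_dim p q) (meridian_field p k) (linear_form p c) =
      time_scale p k * (\<Sum>i\<le>p. Const (c i) * quadratic_field p i)"
    by (simp add: meridian_field_def vf_apply_scale linear_form_def vf.sum vf_apply_mult
        vf_apply_Const vf_apply_Var)
  have on_zero_set: "w p * (\<Sum>i<p. c i * real (p - i) * w i) = c p * (\<Sum>i<p. real (p - i) * (w i)\<^sup>2)"
    if w: "w 0 \<noteq> 0" "(\<Sum>i\<le>p. c i * w i) = 0" for w :: "nat \<Rightarrow> real"
  proof -
    define v where "v = vec (ambient_dim p q) (\<lambda>i. if i \<le> p then w i else 1)"
    have v: "v $ i = w i" if "i \<le> p" for i
      using that by (simp add: v_def)
    have v': "v $ (p + 1) = 1" using q by (simp add: v_def)
    have "eval_poly (time_scale p k) v * (\<Sum>i\<le>p. c i * eval_poly (quadratic_field p i) v) = 0"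
      using arg_cong[OF trans[OF form[symmetric] inv], of "\<lambda>f. eval_poly f v"] w(2)
      by (simp add: eval_poly_mult eval.hom_sum eval_poly_linear_form v)
    moreover have "eval_poly (time_scale p k) v \<noteq> 0"
      using w(1) v' by (simp add: time_scale_def eval_poly_mult eval.hom_power v)
    ultimately have "(\<Sum>i\<le>p. c i * eval_poly (quadratic_field p i) v) = 0" by simp
    then have "(\<Sum>i<p. c i * eval_poly (quadratic_field p i) v) + c p * eval_poly (quadratic_field p p) v = 0"
      by (simp flip: lessThan_Suc_atMost)
    then show ?thesis
      by (simp add: quadratic_field_def eval_poly_mult eval.hom_sum eval.hom_power eval.hom_uminus v
          sum_distrib_left mult_ac)
  qed
  have cp: "c p = 0"
  proof (rule ccontr)
    assume cp: "c p \<noteq> 0"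
    \<comment> \<open>At this point of the hyperplane, the left side of the identity divided by \<open>c p\<close> is at most 0,
      while the right side divided by \<open>c p\<close> is positive.\<close>
    define w where "w = (\<lambda>i. (if i = 0 then 1 else 0) - (if i = p then c 0 / c p else 0))"
    have wp: "w p = - (c 0 / c p)" using p by (simp add: w_def)
    have "(\<Sum>i\<le>p. c i * w i) = (\<Sum>i\<le>p. (if i = 0 then c 0 else 0) - (if i = p then c 0 else 0))"
      using cp by (intro sum.cong) (auto simp: w_def)
    then have "(\<Sum>i\<le>p. c i * w i) = 0"
      by (simp add: sum_subtractf)
    moreover have "w 0 \<noteq> 0" using p by (simp add: w_def)
    moreover have sums: "(\<Sum>i<p. c i * real (p - i) * w i) = c 0 * real p"
        "(\<Sum>i<p. real (p - i) * (w i)\<^sup>2) = real p"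
    proof -
      have "(\<Sum>i<p. c i * real (p - i) * w i) = (\<Sum>i<p. if i = 0 then c 0 * real p else 0)"
        by (intro sum.cong) (auto simp: w_def)
      then show "(\<Sum>i<p. c i * real (p - i) * w i) = c 0 * real p" using p by simp
      have "(\<Sum>i<p. real (p - i) * (w i)\<^sup>2) = (\<Sum>i<p. if i = 0 then real p else 0)"
        by (intro sum.cong) (auto simp: w_def)
      then show "(\<Sum>i<p. real (p - i) * (w i)\<^sup>2) = real p" using p by simp
    qed
    ultimately have "w p * (\<Sum>i<p. c i * real (p - i) * w i) = c p * (\<Sum>i<p. real (p - i) * (w i)\<^sup>2)"
      using on_zero_set by blast
    then have "- (c 0 / c p) * (c 0 * real p) = c p * real p"
      unfolding wp sums .
    then have "real p * ((c 0)\<^sup>2 + (c p)\<^sup>2) = 0"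
      using cp by (simp add: field_simps power2_eq_square)
    then have "(c 0)\<^sup>2 + (c p)\<^sup>2 = 0"
      using p by simp
    then show False using cp by (simp add: sum_power2_eq_zero_iff)
  qed
  have unique: "i = j" if "i < p" "j < p" "c i \<noteq> 0" "c j \<noteq> 0" "c 0 \<noteq> 0 \<Longrightarrow> i = 0" for i j
  proof (rule ccontr)
    assume ij: "i \<noteq> j"
    \<comment> \<open>This point separates the weights of \<open>i\<close> and \<open>j\<close>. Its coordinate \<open>x\<^sub>0\<close> must not vanish, lest
      the time factor does; if \<open>c 0 \<noteq> 0\<close>, this is why \<open>i = 0\<close> is required.\<close>
    define w where "w = (\<lambda>l. if l = i then c j else if l = j then - c i
        else if l = 0 \<or> l = p then 1 else 0)"
    have terms: "c l * w l = (if l = i then c i * c j else 0) - (if l = j then c i * c j else 0)" for l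
      using ij that(5) cp by (auto simp: w_def)
    have "(\<Sum>l\<le>p. c l * w l) = 0"
      using that(1,2) by (simp add: terms sum_subtractf)
    moreover have "w 0 \<noteq> 0" using that ij by (auto simp: w_def)
    moreover have "w p = 1" using that(1,2) by (simp add: w_def)
    ultimately have "(\<Sum>l<p. real (p - l) * (c l * w l)) = 0"
      using on_zero_set[of w] cp by (simp add: mult_ac)
    moreover have "(\<Sum>l<p. real (p - l) * (c l * w l)) =
        (\<Sum>l<p. (if l = i then real (p - i) * (c i * c j) else 0) -
          (if l = j then real (p - j) * (c i * c j) else 0))"
      by (intro sum.cong) (auto simp: terms)
    ultimately have "real (p - i) * (c i * c j) = real (p - j) * (c i * c j)"
      using that(1,2) by (simp add: sum_subtractf)
    then show False using that ij by auto
  qed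
  have "\<exists>i<p. c i \<noteq> 0 \<and> (c 0 \<noteq> 0 \<longrightarrow> i = 0)"
  proof (cases "c 0 = 0")
    case True
    obtain i where "i \<le> p" "c i \<noteq> 0" using nz by blast
    moreover from this have "i \<noteq> p" using cp by metis
    ultimately show ?thesis using True by (intro exI[of _ i]) simp
  next
    case False
    then show ?thesis using p by (intro exI[of _ 0]) simp
  qed
  then obtain i where i: "i < p" "c i \<noteq> 0" "c 0 \<noteq> 0 \<Longrightarrow> i = 0" by blast
  have "c j = c i * axis i j" if j: "j \<le> p" for j
  proof (cases "c j = 0")
    case True
    then show ?thesis using i(2) by (auto simp: axis_def)
  next
    case False
    then have "j \<noteq> p" using cp by metis
    then have "i = j" using unique[of i j] i False j by simp
    then show ?thesis by (simp add: axis_def)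
  qed
  then show thesis using that i(1) by blast
qed

definition axis_meridian :: "nat \<Rightarrow> nat \<Rightarrow> real \<Rightarrow> nat \<Rightarrow> real vec set" where
  "axis_meridian p q a s = S_hypersurface p q a \<inter> hyperplane p q (axis s)"

lemma defines_axis_meridian: "s \<le> p \<Longrightarrow> defines_meridian p q a (axis s) (axis_meridian p q a s)"
  by (auto simp: defines_meridian_def axis_meridian_def axis_def)

lemma invariant_meridians_meridian_field:
  assumes p: "p \<ge> 1" and q: "q \<ge> 1"
  shows "invariant_meridians p q a (meridian_field p k) = axis_meridian p q a ` {..<p}"
proof (intro equalityI subsetI)
  fix M assume "M \<in> invariant_meridians p q a (meridian_field p k)"
  then obtain c K where c: "defines_meridian p q a c M"
    and inv: "vf_apply (ambient_dim p q) (meridian_field p k) (linear_form p c) = K * linear_form p c"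
    by (auto simp: invariant_meridians_def)
  obtain s where s: "s < p" and cs: "\<And>i. i \<le> p \<Longrightarrow> c i = c s * axis s i"
    using invariant_linear_form_is_axis[OF p q _ inv] c by (auto simp: defines_meridian_def)
  have "c s \<noteq> 0" using c cs by (auto simp: defines_meridian_def)
  moreover have "linear_form p c = Const (c s) * linear_form p (axis s)"
    by (rule linear_form_scale) (rule cs)
  ultimately have "hyperplane p q c = hyperplane p q (axis s)"
    by (simp add: hyperplane_def eval_poly_mult)
  then show "M \<in> axis_meridian p q a ` {..<p}"
    using c s by (auto simp: defines_meridian_def axis_meridian_def)
next
  fix M assume "M \<in> axis_meridian p q a ` {..<p}"
  then obtain s where s: "s < p" and M: "M = axis_meridian p q a s" by auto
  have "vf_apply (ambient_dim p q) (meridian_field p k) (linear_form p (axis s)) =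
      (time_scale p k * (Const (real (p - s)) * Var p)) * linear_form p (axis s)"
    using s by (simp add: linear_form_axis vf_apply_Var meridian_field_def quadratic_field_def mult_ac)
  moreover have "time_scale p k * (Const (real (p - s)) * Var p) \<in> polys (ambient_dim p q)"
    using time_scale_polys[OF q] by (intro polys_mult polys_Const polys_Var) simp_all
  ultimately show "M \<in> invariant_meridians p q a (meridian_field p k)"
    unfolding invariant_meridians_def M using defines_axis_meridian[of s p q a] s by fastforce
qed

lemma inj_on_axis_meridian:
  assumes q: "q \<ge> 1" and a: "a > 0"
  shows "inj_on (axis_meridian p q a) {..<p}"
proof
  fix s s' assume s: "s \<in> {..<p}" "s' \<in> {..<p}" and eq: "axis_meridian p q a s = axis_meridian p q a s'"
  have "defines_meridian p q a (axis s) (axis_meridian p q a s)"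
    using defines_axis_meridian[of s p q a] s by simp
  moreover have "defines_meridian p q a (axis s') (axis_meridian p q a s)"
    using defines_axis_meridian[of s' p q a] s eq by simp
  ultimately obtain t where t: "\<And>i. i \<le> p \<Longrightarrow> axis s' i = t * axis s i"
    using meridian_determines_linear_form[OF q a] by metis
  show "s = s'"
    using t[of s'] s by (auto simp: axis_def split: if_splits)
qed

section \<open>The extactic polynomial and the count\<close>

text \<open>The quadratic field vanishes at this point, which lies on every hyperplane \<open>x\<^sub>s = 0\<close> with
  \<open>s < p\<close>. A polynomial that does not vanish here is therefore divisible by none of those \<open>x\<^sub>s\<close>.\<close>

definition pole :: "nat \<Rightarrow> nat \<Rightarrow> real vec" where
  "pole p q = vec (ambient_dim p q) (\<lambda>i. if i = p then 1 else 0)"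

lemma quadratic_field_vanishes_at_pole:
  assumes "i < ambient_dim p q"
  shows "eval_poly (quadratic_field p i) (pole p q) = 0"
  using assms
  by (simp add: quadratic_field_def pole_def eval_poly_mult eval.hom_sum eval.hom_uminus eval.hom_power)

lemma vf_apply_quadratic_field_at_pole:
  "eval_poly (vf_apply (ambient_dim p q) (quadratic_field p) f) (pole p q) = 0"
  unfolding vf_apply_def eval.hom_sum eval_poly_mult
  by (intro sum.neutral ballI) (metis lessThan_iff quadratic_field_vanishes_at_pole mult_zero_left)

text \<open>The exponents of the variables in the monomial part of the extactic polynomial: the sum
  \<open>\<Sum>r<p + 1. r\<close> is the power to which the time factor enters it, and the last summand accounts for the
  invariant coordinate hyperplanes of the quadratic field.\<close>

definition extactic_exponent :: "nat \<Rightarrow> nat \<Rightarrow> nat \<Rightarrow> nat" where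
  "extactic_exponent p k j =
     (if j = p + 1 then 2 * (\<Sum>r<p + 1. r) else 0) + (if j = 0 then k * (\<Sum>r<p + 1. r) else 0) +
     (if j < p then 1 else 0)"

text \<open>After the time factor and the invariant forms are split off, the determinant of the cofactor
  iterates remains. At the pole the quadratic field vanishes, so all derivatives drop out and only
  powers of the weights \<open>p - s\<close> survive. The column of \<open>x\<^sub>p\<close> becomes \<open>(1, 0, \<dots>, 0)\<close>, the powers of
  its weight 0, so the value is a Vandermonde determinant with distinct nodes.\<close>

lemma extactic_meridian_field:
  obtains F where "extactic p q (meridian_field p k) = (\<Prod>j\<le>p + 1. Var j ^ extactic_exponent p k j) * F"
    and "eval_poly F (pole p q) \<noteq> 0"
proof -
  define D where "D = vf_apply (ambient_dim p q) (quadratic_field p)"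
  interpret D: derivation D unfolding D_def by (rule vf.derivation_axioms)
  have D_pole: "eval_poly (D f) (pole p q) = 0" for f
    unfolding D_def by (rule vf_apply_quadratic_field_at_pole)
  define B where "B r s = ((\<lambda>g. D g + Const (real (p - s)) * Var p * g) ^^ r) 1" for r s
  define C where "C r s = (if s < p then B r s else (D ^^ r) (Var p))" for r s
  define F where "F = det (mat (p + 1) (p + 1) (\<lambda>(r, s). C r s))"
  have entry: "(D ^^ r) (Var s) = C r s * (if s < p then Var s else 1)" if "s < p + 1" for r s
  proof (cases "s < p")
    case True
    then have "D (Var s) = Const (real (p - s)) * Var p * Var s"
      by (simp add: D_def vf_apply_Var quadratic_field_def mult_ac)
    then show ?thesis using True by (simp add: D.iterate_cofactor B_def C_def)
  next
    case False
    then show ?thesis using that by (simp add: C_def less_Suc_eq)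
  qed
  have "extactic p q (meridian_field p k) =
      det (mat (p + 1) (p + 1) (\<lambda>(r, s). ((\<lambda>g. time_scale p k * D g) ^^ r) (Var s)))"
    unfolding extactic_def meridian_field_def D_def by (simp add: vf_apply_scale[abs_def])
  also have "\<dots> = time_scale p k ^ (\<Sum>r<p + 1. r) *
      det (mat (p + 1) (p + 1) (\<lambda>(r, s). (D ^^ r) (Var s)))"
    by (rule D.det_iterates_rescaled)
  also have "mat (p + 1) (p + 1) (\<lambda>(r, s). (D ^^ r) (Var s)) =
      mat (p + 1) (p + 1) (\<lambda>(r, s). C r s * (if s < p then Var s else 1))"
    by (intro eq_matI) (simp_all add: entry)
  also have "det \<dots> = F * (\<Prod>s<p + 1. if s < p then Var s else 1)"
    unfolding F_def by (rule det_scale_columns)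
  also have "time_scale p k ^ (\<Sum>r<p + 1. r) * (F * (\<Prod>s<p + 1. if s < p then Var s else 1)) =
      (\<Prod>j\<le>p + 1. Var j ^ extactic_exponent p k j) * F"
  proof -
    have delta: "(\<Prod>j\<le>p + 1. Var j ^ (if j = l then n else 0)) = Var l ^ n" if "l \<le> p + 1" for l n
    proof -
      have "(\<Prod>j\<le>p + 1. Var j ^ (if j = l then n else 0)) = (\<Prod>j\<le>p + 1. if j = l then Var l ^ n else 1)"
        by (intro prod.cong) auto
      then show ?thesis using that by simp
    qed
    have axes: "(\<Prod>j\<le>p + 1. Var j ^ (if j < p then 1 else 0)) = (\<Prod>s<p + 1. if s < p then Var s else 1)"
      by (intro prod.mono_neutral_cong_right) auto
    show ?thesis
      unfolding extactic_exponent_def power_add prod.distrib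
      using delta[of "p + 1"] delta[of 0] axes
      by (simp add: time_scale_def power_mult_distrib mult_ac flip: power_mult)
  qed
  finally have "extactic p q (meridian_field p k) = (\<Prod>j\<le>p + 1. Var j ^ extactic_exponent p k j) * F" .
  moreover have "eval_poly F (pole p q) \<noteq> 0"
  proof -
    have pole_p: "pole p q $ p = 1" by (simp add: pole_def)
    have B: "eval_poly (B r s) (pole p q) = real (p - s) ^ r" for r s
      by (induction r)
        (simp_all add: B_def eval_poly_add eval_poly_mult D_pole pole_p)
    have C: "eval_poly (C r s) (pole p q) = real (p - s) ^ r" if "s < p + 1" for r s
    proof (cases "s < p")
      case False
      then have "s = p" using that by simp
      then show ?thesis
        by (cases r) (simp_all add: C_def pole_p D_pole)
    qed (simp add: C_def B)
    have "eval_poly F (pole p q) =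
        det (map_mat (\<lambda>f. eval_poly f (pole p q)) (mat (p + 1) (p + 1) (\<lambda>(r, s). C r s)))"
      by (simp add: F_def)
    also have "map_mat (\<lambda>f. eval_poly f (pole p q)) (mat (p + 1) (p + 1) (\<lambda>(r, s). C r s)) =
        mat (p + 1) (p + 1) (\<lambda>(r, s). real (p - s) ^ r)"
      by (intro eq_matI) (auto simp: C)
    also have "det \<dots> \<noteq> 0"
      by (rule vandermonde_det_nonzero) (auto simp: inj_on_def)
    finally show ?thesis .
  qed
  ultimately show thesis by (rule that)
qed

text \<open>The meridian \<open>x\<^sub>0 = 0\<close> takes up all of the time factor \<open>x\<^sub>0\<^sup>k\<close>; the other \<open>p - 1\<close> are simple.\<close>

lemma num_invariant_meridians_meridian_field:
  assumes p: "p \<ge> 1" and q: "q \<ge> 1" and a: "a > 0"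
  shows "num_invariant_meridians_with_mult p q a (meridian_field p k) (p + k * (\<Sum>r\<le>p. r))"
proof -
  obtain F where E: "extactic p q (meridian_field p k) = (\<Prod>j\<le>p + 1. Var j ^ extactic_exponent p k j) * F"
    and F: "eval_poly F (pole p q) \<noteq> 0"
    by (rule extactic_meridian_field)
  have mult: "meridian_multiplicity p q a (meridian_field p k) (axis_meridian p q a s) = extactic_exponent p k s"
    if s: "s < p" for s
  proof -
    have "\<not> Var s dvd F"
      using F s by (auto simp: eval_poly_mult pole_def elim!: dvdE)
    then have "linear_form p (axis s) ^ n dvd extactic p q (meridian_field p k) \<longleftrightarrow> n \<le> extactic_exponent p k s" for n
      using s Var_power_dvd_monomial_mult_iff[of "{..p + 1}" s F n "extactic_exponent p k"]
      by (simp add: linear_form_axis E)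
    then have "hyperplane_multiplicity p q (meridian_field p k) (axis s) = extactic_exponent p k s"
      unfolding hyperplane_multiplicity_def by (intro Greatest_equality) auto
    then show ?thesis
      using meridian_multiplicity_eq[OF q a defines_axis_meridian[of s p q a]] s by simp
  qed
  have "(\<Sum>M\<in>invariant_meridians p q a (meridian_field p k).
      meridian_multiplicity p q a (meridian_field p k) M) = (\<Sum>s<p. extactic_exponent p k s)"
    by (simp add: invariant_meridians_meridian_field[OF p q] sum.reindex[OF inj_on_axis_meridian[OF q a]] mult)
  also have "\<dots> = (\<Sum>s<p. (if s = 0 then k * (\<Sum>r\<le>p. r) else 0) + 1)"
    by (intro sum.cong) (auto simp: extactic_exponent_def simp flip: lessThan_Suc_atMost)
  also have "\<dots> = p + k * (\<Sum>r\<le>p. r)"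
    using p by (subst sum.distrib) simp
  finally have "(\<Sum>M\<in>invariant_meridians p q a (meridian_field p k).
      meridian_multiplicity p q a (meridian_field p k) M) = p + k * (\<Sum>r\<le>p. r)" .
  moreover have "F \<noteq> 0" using F by auto
  then have "extactic p q (meridian_field p k) \<noteq> 0"
    by (simp add: E)
  ultimately show ?thesis
    by (simp add: num_invariant_meridians_with_mult_def invariant_meridians_meridian_field[OF p q])
qed

theorem theorem4p7:
  fixes q m :: nat and a :: real
  assumes "q \<ge> 1" and "a > 1" and "m \<ge> 4"
  shows "(\<exists>X. poly_vector_field_on_S 2 q a X \<and> vf_degree (ambient_dim 2 q) X = m \<and>
            num_invariant_meridians_with_mult 2 q a X (3 * m - 10)) \<and>
         (\<exists>X. poly_vector_field_on_S 3 q a X \<and> vf_degree (ambient_dim 3 q) X = m \<and>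
            num_invariant_meridians_with_mult 3 q a X (6 * m - 21))"
proof -
  define k where "k = m - 4"
  have m: "m = k + 4" using assms(3) by (simp add: k_def)
  have exists: "\<exists>X. poly_vector_field_on_S p q a X \<and> vf_degree (ambient_dim p q) X = m \<and>
      num_invariant_meridians_with_mult p q a X (p + k * (\<Sum>r\<le>p. r))" if "p \<ge> 1" for p
  proof (intro exI[of _ "meridian_field p k"] conjI)
    show "poly_vector_field_on_S p q a (meridian_field p k)"
      by (rule meridian_field_on_S) (rule assms(1))
    show "vf_degree (ambient_dim p q) (meridian_field p k) = m"
      unfolding m by (rule degree_meridian_field) (rule that)
    show "num_invariant_meridians_with_mult p q a (meridian_field p k) (p + k * (\<Sum>r\<le>p. r))"
      using assms(2) by (intro num_invariant_meridians_meridian_field that assms(1)) simp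
  qed
  have "(\<Sum>r\<le>2. r) = (3 :: nat)" and "(\<Sum>r\<le>3. r) = (6 :: nat)"
    by (simp_all add: numeral_2_eq_2 numeral_3_eq_3)
  then have counts: "2 + k * (\<Sum>r\<le>2. r) = 3 * m - 10" "3 + k * (\<Sum>r\<le>3. r) = 6 * m - 21"
    by (simp_all add: m)
  show ?thesis
  proof (rule conjI)
    show "\<exists>X. poly_vector_field_on_S 2 q a X \<and> vf_degree (ambient_dim 2 q) X = m \<and>
        num_invariant_meridians_with_mult 2 q a X (3 * m - 10)"
      unfolding counts[symmetric] by (rule exists) simp
    show "\<exists>X. poly_vector_field_on_S 3 q a X \<and> vf_degree (ambient_dim 3 q) X = m \<and>
        num_invariant_meridians_with_mult 3 q a X (6 * m - 21)"
      unfolding counts[symmetric] by (rule exists) simp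
  qed
qed

end
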